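(* Let $\mathcal{B}=(e_n)_{n=1}^\infty$ be a basis of an infinite-dimensional Banach space $\mathbb{X}$ over $\mathbb{K}=\mathbb{R}$ or $\mathbb{C}$. Then $\mathcal{B}$ is partially greedy (PG) if and only if there exists a constant $\mathbf{C}\geqslant 1$ such that $$\|x-P_{\Lambda}(x)\|\ \leqslant\ \mathbf{C}\,\hat{\sigma}^{\Lambda}_m(x)\quad\text{for all } x\in\mathbb{X},\ m\in\mathbb{N},\ \Lambda\in G(x,m),$$ where $$\hat{\sigma}^{\Lambda}_m(x)=\inf\{\|x-P_I(x)\|:\ \text{either } I=\emptyset,\ \text{or } I \text{ is an interval with } \Lambda\geqslant\min I,\ |I|\leqslant m\}.$$
   Context: $\mathbb{N}=\{1,2,\ldots\}$. A basis of $\mathbb{X}$ is a sequence $\mathcal{B}=(e_n)_{n=1}^\infty$ in $\mathbb{X}$ such that: (i) the linear span of $(e_n)_n$ is norm-dense in $\mathbb{X}$; (ii) there are biorthogonal functionals $(e_n^* )_n\subset\mathbb{X}^*$, i.e. $e_n^*(e_m)=\delta_{n,m}$; (iii) there are $c_1,c_2>0$ with $c_1\leqslant\|e_n\|,\|e_n^*\|\leqslant c_2$ for all $n$. (Totality of $(e_n^* )_n$ and the Schauder property are not assumed.) For a finite set $A\subset\mathbb{N}$, $P_A(x)=\sum_{n\in A}e_n^*(x)e_n$. A finite set $\Lambda\subset\mathbb{N}$ is a greedy set of $x$ if $\min_{n\in\Lambda}|e_n^*(x)|\geqslant\max_{n\notin\Lambda}|e_n^*(x)|$; $G(x,m)$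 is the set of all greedy sets of $x$ of cardinality $m$. An interval is a set of consecutive positive integers. $\Lambda\geqslant\min I$ means $n\geqslant\min I$ for all $n\in\Lambda$. $\mathcal{B}$ is PG if there is $\mathbf{C}\geqslant 1$ such that for all $x\in\mathbb{X}$, $m\in\mathbb{N}$, $\Lambda\in G(x,m)$, $$\|x-P_\Lambda(x)\|\leqslant\mathbf{C}\inf_{0\leqslant k\leqslant m}\left\|x-\sum_{n=1}^k e_n^*(x)e_n\right\|,$$ where the sum is $0$ for $k=0$. *)

theory Defs
  imports "HOL-Analysis.Analysis"
begin

(* Scalars: real and complex are instances of real_normed_field, and by Gelfand-Mazur
   they are the only ones up to isometric isomorphism, so a type variable of this class
   renders K = R or C.  Completeness of the space comes from the class banach; the last
   axiom says that the real structure of the type is the restriction of the K-structure. *)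
locale banach_space_over = vector_space smul
  for smul :: "'k::real_normed_field \<Rightarrow> 'a::banach \<Rightarrow> 'a" +
  assumes norm_smul: "norm (smul c x) = norm c * norm x"
    and smul_of_real: "smul (of_real r) x = r *\<^sub>R x"

definition infinite_dimensional ::
    "('k::real_normed_field \<Rightarrow> 'a::banach \<Rightarrow> 'a) \<Rightarrow> bool" where
  "infinite_dimensional smul \<longleftrightarrow> \<not> (\<exists>B. finite B \<and> module.span smul B = UNIV)"

(* bounded_linear is over the reals; homogeneity upgrades it to K-linearity. *)
definition dual_functional ::
    "('k::real_normed_field \<Rightarrow> 'a::banach \<Rightarrow> 'a) \<Rightarrow> ('a \<Rightarrow> 'k) \<Rightarrow> bool" where
  "dual_functional smul f \<longleftrightarrow> bounded_linear f \<and> (\<forall>c x. f (smul c x) = c * f x)"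

(* Indices run over {1..}; the values at 0 are never used.  The functionals es are carried
   along with e: by (i) and (ii) they are determined by e. *)
definition is_basis ::
    "('k::real_normed_field \<Rightarrow> 'a::banach \<Rightarrow> 'a) \<Rightarrow> (nat \<Rightarrow> 'a) \<Rightarrow> (nat \<Rightarrow> 'a \<Rightarrow> 'k) \<Rightarrow> bool" where
  "is_basis smul e es \<longleftrightarrow>
     closure (module.span smul (e ` {1..})) = UNIV \<and>
     (\<forall>n\<ge>1. dual_functional smul (es n)) \<and>
     (\<forall>n\<ge>1. \<forall>m\<ge>1. es n (e m) = (if n = m then 1 else 0)) \<and>
     (\<exists>c1 c2. 0 < c1 \<and> 0 < c2 \<and>
        (\<forall>n\<ge>1. c1 \<le> norm (e n) \<and> norm (e n) \<le> c2 \<and> c1 \<le> onorm (es n) \<and> onorm (es n) \<le> c2))"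

definition coord_proj ::
    "('k::real_normed_field \<Rightarrow> 'a::banach \<Rightarrow> 'a) \<Rightarrow> (nat \<Rightarrow> 'a) \<Rightarrow> (nat \<Rightarrow> 'a \<Rightarrow> 'k) \<Rightarrow>
     nat set \<Rightarrow> 'a \<Rightarrow> 'a" where
  "coord_proj smul e es A x = (\<Sum>n\<in>A. smul (es n x) (e n))"

definition greedy_sets ::
    "(nat \<Rightarrow> 'a::banach \<Rightarrow> 'k::real_normed_field) \<Rightarrow> 'a \<Rightarrow> nat \<Rightarrow> nat set set" where
  "greedy_sets es x m =
     {\<Lambda>. finite \<Lambda> \<and> \<Lambda> \<subseteq> {1..} \<and> card \<Lambda> = m \<and>
         (\<forall>n\<in>\<Lambda>. \<forall>k\<in>{1..} - \<Lambda>. norm (es n x) \<ge> norm (es k x))}"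

definition partially_greedy ::
    "('k::real_normed_field \<Rightarrow> 'a::banach \<Rightarrow> 'a) \<Rightarrow> (nat \<Rightarrow> 'a) \<Rightarrow> (nat \<Rightarrow> 'a \<Rightarrow> 'k) \<Rightarrow> bool" where
  "partially_greedy smul e es \<longleftrightarrow>
     (\<exists>C\<ge>1. \<forall>x. \<forall>m\<ge>1. \<forall>\<Lambda>\<in>greedy_sets es x m.
        norm (x - coord_proj smul e es \<Lambda> x)
          \<le> C * (INF k\<in>{0..m}. norm (x - (\<Sum>n=1..k. smul (es n x) (e n)))))"

(* Nonempty and finite; the empty set is admitted separately in sigma_hat. *)
definition int_interval :: "nat set \<Rightarrow> bool" where
  "int_interval I \<longleftrightarrow> (\<exists>a b. 1 \<le> a \<and> a \<le> b \<and> I = {a..b})"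

definition sigma_hat ::
    "('k::real_normed_field \<Rightarrow> 'a::banach \<Rightarrow> 'a) \<Rightarrow> (nat \<Rightarrow> 'a) \<Rightarrow> (nat \<Rightarrow> 'a \<Rightarrow> 'k) \<Rightarrow>
     nat set \<Rightarrow> nat \<Rightarrow> 'a \<Rightarrow> real" where
  "sigma_hat smul e es \<Lambda> m x =
     Inf {norm (x - coord_proj smul e es I x) | I.
            I = {} \<or> (int_interval I \<and> (\<forall>n\<in>\<Lambda>. Min I \<le> n) \<and> card I \<le> m)}"

end

theory Submission
  imports Defs
begin

text \<open>
  One direction is immediate: every initial segment \<open>{1..k}\<close> with \<open>k \<le> m\<close> is empty or an interval
  admitted in \<open>sigma_hat\<close>, so \<open>sigma_hat\<close> lies below the infimum over partial sums.

  For the converse let \<open>\<Lambda>\<close> be a greedy set of \<open>x\<close> with \<open>m\<close> elements and let \<open>I = {a..b}\<close> with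
  \<open>|I| \<le> m\<close> and \<open>a \<le> min \<Lambda>\<close>.  Put \<open>y = x - P\<^bsub>I\<^esub> x\<close>, \<open>A = I - \<Lambda>\<close> and \<open>B = \<Lambda> - I\<close>, so that
  \<open>x - P\<^bsub>\<Lambda>\<^esub> x = (y - P\<^bsub>B\<^esub> y) + P\<^bsub>A\<^esub> x\<close>.  Removing the coefficients on \<open>I\<close> leaves \<open>B\<close> greedy for \<open>y\<close>,
  hence \<open>\<parallel>y - P\<^bsub>B\<^esub> y\<parallel> \<le> C \<parallel>y\<parallel>\<close> by comparison with the empty partial sum.  The condition
  \<open>a \<le> min \<Lambda>\<close> forces \<open>B\<close> to lie entirely to the right of \<open>I\<close>, and \<open>|A| \<le> |B|\<close>; moreover the
  coefficients of \<open>x\<close> on \<open>A\<close> are dominated by those on \<open>B\<close>.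

  The point is then that \<open>\<parallel>P\<^bsub>A\<^esub> x\<parallel> \<le> C \<parallel>P\<^bsub>B\<^esub> x\<parallel>\<close> (lemma \<open>norm_coord_proj_left_le_right\<close>).  This comes
  from a single application of partial greediness to \<open>P\<^bsub>A\<^esub> x + t (\<Sum>n\<in>{1..b} - A. e n) + P\<^bsub>B\<^esub> x\<close>,
  where \<open>t\<close> is the least modulus of a coefficient on \<open>B\<close>: the set \<open>({1..b} - A) \<union> B\<close> is greedy, has
  at least \<open>b\<close> elements and leaves the remainder \<open>P\<^bsub>A\<^esub> x\<close>, whereas subtracting the \<open>b\<close>-th partial sum
  leaves \<open>P\<^bsub>B\<^esub> x\<close>.  Altogether \<open>\<parallel>x - P\<^bsub>\<Lambda>\<^esub> x\<parallel> \<le> (C + C (1 + C)) \<parallel>y\<parallel>\<close>.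
\<close>

locale biorthogonal_system = banach_space_over smul
  for smul :: "'k::real_normed_field \<Rightarrow> 'a::banach \<Rightarrow> 'a" +
  fixes e :: "nat \<Rightarrow> 'a" and es :: "nat \<Rightarrow> 'a \<Rightarrow> 'k"
  assumes dual: "n \<ge> 1 \<Longrightarrow> dual_functional smul (es n)"
    and biorthogonal: "n \<ge> 1 \<Longrightarrow> m \<ge> 1 \<Longrightarrow> es n (e m) = (if n = m then 1 else 0)"
begin

abbreviation P :: "nat set \<Rightarrow> 'a \<Rightarrow> 'a" where
  "P \<equiv> coord_proj smul e es"

lemma es_diff: "n \<ge> 1 \<Longrightarrow> es n (x - y) = es n x - es n y"
  using dual[of n] unfolding dual_functional_def by (simp add: bounded_linear.linear linear_diff)

lemma es_sum:
  assumes "finite F" "F \<subseteq> {1..}" "k \<ge> 1"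
  shows "es k (\<Sum>n\<in>F. smul (c n) (e n)) = (if k \<in> F then c k else 0)"
proof -
  have lin: "linear (es k)" and hom: "\<And>c x. es k (smul c x) = c * es k x"
    using dual[OF assms(3)] by (auto simp: dual_functional_def bounded_linear.linear)
  have "es k (\<Sum>n\<in>F. smul (c n) (e n)) = (\<Sum>n\<in>F. c n * es k (e n))"
    by (simp add: linear_sum[OF lin] hom)
  also have "\<dots> = (\<Sum>n\<in>F. if n = k then c n else 0)"
    using assms by (intro sum.cong) (auto simp: biorthogonal subset_iff)
  finally show ?thesis using assms(1) by simp
qed

lemma es_P:
  assumes "finite F" "F \<subseteq> {1..}" "k \<ge> 1"
  shows "es k (P F x) = (if k \<in> F then es k x else 0)"
  unfolding coord_proj_def by (rule es_sum[OF assms])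

lemma P_cong:
  assumes "\<And>n. n \<in> F \<Longrightarrow> es n x = es n y"
  shows "P F x = P F y"
  unfolding coord_proj_def using assms by (intro sum.cong) auto

lemma P_Un: "finite F \<Longrightarrow> finite G \<Longrightarrow> F \<inter> G = {} \<Longrightarrow> P (F \<union> G) x = P F x + P G x"
  unfolding coord_proj_def by (rule sum.union_disjoint)

lemma P_empty [simp]: "P {} x = 0"
  by (simp add: coord_proj_def)

lemma P_sum_self:
  assumes "finite F" "F \<subseteq> {1..}" "G \<subseteq> F" "z = (\<Sum>n\<in>F. smul (c n) (e n))"
  shows "P G z = (\<Sum>n\<in>G. smul (c n) (e n))"
  unfolding coord_proj_def using assms
  by (intro sum.cong) (auto simp: es_sum subset_iff)

text \<open>
  Partial greediness with the infimum resolved.  Stating it for the cardinality of the set itself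
  lets empty greedy sets be used too; for them it is trivial because \<open>C \<ge> 1\<close>.
\<close>

lemma partially_greedyE:
  assumes "partially_greedy smul e es"
  obtains C where "C \<ge> 1"
    "\<And>x \<Lambda> k. \<Lambda> \<in> greedy_sets es x (card \<Lambda>) \<Longrightarrow> k \<le> card \<Lambda> \<Longrightarrow>
      norm (x - P \<Lambda> x) \<le> C * norm (x - P {1..k} x)"
proof -
  obtain C where C: "C \<ge> 1" and pg: "\<And>x m \<Lambda>. m \<ge> 1 \<Longrightarrow> \<Lambda> \<in> greedy_sets es x m \<Longrightarrow>
      norm (x - P \<Lambda> x) \<le> C * (INF k\<in>{0..m}. norm (x - (\<Sum>n=1..k. smul (es n x) (e n))))"
    using assms unfolding partially_greedy_def by blast
  have "norm (x - P \<Lambda> x) \<le> C * norm (x - P {1..k} x)"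
    if gr: "\<Lambda> \<in> greedy_sets es x (card \<Lambda>)" and k: "k \<le> card \<Lambda>" for x \<Lambda> k
  proof (cases "card \<Lambda> = 0")
    case True
    then have "\<Lambda> = {}" "k = 0" using gr k by (auto simp: greedy_sets_def)
    then show ?thesis using mult_right_mono[OF C, of "norm x"] by simp
  next
    case False
    have "(INF k\<in>{0..card \<Lambda>}. norm (x - (\<Sum>n=1..k. smul (es n x) (e n))))
        \<le> norm (x - (\<Sum>n=1..k. smul (es n x) (e n)))"
      using k by (intro cINF_lower) auto
    then have "C * (INF k\<in>{0..card \<Lambda>}. norm (x - (\<Sum>n=1..k. smul (es n x) (e n))))
        \<le> C * norm (x - P {1..k} x)"
      using C by (intro mult_left_mono) (auto simp: coord_proj_def)
    with pg[OF _ gr] False show ?thesis by linarith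
  qed
  with C show thesis by (rule that)
qed

text \<open>
  Partial greediness compares only with initial segments \<open>{1..b}\<close>, which may be much longer than
  \<open>A\<close>.  Filling the gaps \<open>{1..b} - A\<close> with coefficients equal to \<open>t\<close>, the
  least modulus of a coefficient on \<open>B\<close>, removes the obstacle: the
  filler belongs both to a greedy set and to the initial segment, so it disappears from both
  remainders, and it makes the greedy set long enough.
\<close>

lemma norm_coord_proj_left_le_right:
  assumes pg: "\<And>x \<Lambda> k. \<Lambda> \<in> greedy_sets es x (card \<Lambda>) \<Longrightarrow> k \<le> card \<Lambda> \<Longrightarrow>
      norm (x - P \<Lambda> x) \<le> C * norm (x - P {1..k} x)"
    and A: "A \<subseteq> {1..b}" and B: "finite B" "B \<subseteq> {b<..}" and card: "card A \<le> card B"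
    and dom: "\<And>n k. n \<in> A \<Longrightarrow> k \<in> B \<Longrightarrow> norm (es n x) \<le> norm (es k x)"
  shows "norm (P A x) \<le> C * norm (P B x)"
proof (cases "B = {}")
  case True
  then have "A = {}" using card A finite_subset by fastforce
  with True show ?thesis by simp
next
  case False
  define t where "t = Min ((\<lambda>k. norm (es k x)) ` B)"
  have t_le: "t \<le> norm (es k x)" if "k \<in> B" for k
    using that B unfolding t_def by auto
  have t_in: "t \<in> (\<lambda>k. norm (es k x)) ` B"
    unfolding t_def using B False by (intro Min_in) auto
  then have t_ge: "norm (es n x) \<le> t" if "n \<in> A" for n
    using dom[OF that] by auto
  from t_in have t0: "t \<ge> 0" by auto
  have finA: "finite A" using A finite_subset by blast
  define c where "c n = (if n \<in> A \<union> B then es n x else of_real t)" for n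
  define z where "z = (\<Sum>n\<in>{1..b} \<union> B. smul (c n) (e n))"
  define \<Lambda> where "\<Lambda> = ({1..b} - A) \<union> B"
  have supp: "finite ({1..b} \<union> B)" "{1..b} \<union> B \<subseteq> {1..}" using B by auto
  note Pz = P_sum_self[OF supp _ z_def]
  have es_z: "es k z = (if k \<in> {1..b} \<union> B then c k else 0)" if "k \<ge> 1" for k
    unfolding z_def using es_sum[OF supp that] .
  have "{1..b} \<inter> B = {}" using B by auto
  then have disj: "A \<inter> B = {}" "{1..b} \<inter> B = {}" "A \<inter> \<Lambda> = {}" "({1..b} - A) \<inter> B = {}"
    using A unfolding \<Lambda>_def by blast+
  have "t \<le> norm (es n z)" if "n \<in> \<Lambda>" for n
    using that B t_le t0 es_z[of n] by (auto simp: \<Lambda>_def c_def)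
  moreover have "norm (es k z) \<le> t" if "k \<in> {1..} - \<Lambda>" for k
    using that A t_ge t0 es_z[of k] by (auto simp: \<Lambda>_def c_def)
  ultimately have "\<forall>n\<in>\<Lambda>. \<forall>k\<in>{1..} - \<Lambda>. norm (es k z) \<le> norm (es n z)"
    by (meson order_trans)
  moreover have "finite \<Lambda>" "\<Lambda> \<subseteq> {1..}" using supp by (auto simp: \<Lambda>_def)
  ultimately have gr: "\<Lambda> \<in> greedy_sets es z (card \<Lambda>)"
    unfolding greedy_sets_def by blast
  have "card \<Lambda> = card ({1..b} - A) + card B"
    unfolding \<Lambda>_def using B disj by (intro card_Un_disjoint) auto
  also have "card ({1..b} - A) = b - card A" using A finA by (simp add: card_Diff_subset)
  finally have b: "b \<le> card \<Lambda>" using card by simp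
  have "P ({1..b} \<union> B) z = z" by (subst Pz) (auto simp: z_def)
  moreover have "{1..b} \<union> B = A \<union> \<Lambda>" using A by (auto simp: \<Lambda>_def)
  ultimately have "P A z + P \<Lambda> z = z" "P {1..b} z + P B z = z"
    using P_Un[of A \<Lambda> z] P_Un[of "{1..b}" B z] finA B(1) disj \<open>finite \<Lambda>\<close> by simp_all
  then have "z - P \<Lambda> z = P A z" "z - P {1..b} z = P B z"
    by (simp_all add: diff_eq_eq add.commute)
  moreover have "P A z = P A x" "P B z = P B x"
    using A B by (auto intro!: P_cong simp: es_z c_def subset_iff)
  ultimately show ?thesis using pg[OF gr b] by simp
qed

text \<open>
  The two sets \<open>\<Lambda>\<close> and \<open>{a..b}\<close> share the coefficients on their intersection, so the remainders
  differ only by the projections onto \<open>A = {a..b} - \<Lambda>\<close> and \<open>B = \<Lambda> - {a..b}\<close>.  The condition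
  \<open>\<forall>n\<in>\<Lambda>. a \<le> n\<close> places \<open>B\<close> to the right of \<open>b\<close>, as the preceding lemma requires.
\<close>

lemma norm_greedy_remainder_le_interval_remainder:
  assumes C: "C \<ge> 1"
    and pg: "\<And>x \<Lambda> k. \<Lambda> \<in> greedy_sets es x (card \<Lambda>) \<Longrightarrow> k \<le> card \<Lambda> \<Longrightarrow>
      norm (x - P \<Lambda> x) \<le> C * norm (x - P {1..k} x)"
    and gr: "\<Lambda> \<in> greedy_sets es x m"
    and I: "1 \<le> a" "\<forall>n\<in>\<Lambda>. a \<le> n" "card {a..b} \<le> m"
  shows "norm (x - P \<Lambda> x) \<le> (C + C * (1 + C)) * norm (x - P {a..b} x)"
proof -
  define y where "y = x - P {a..b} x"
  define A where "A = {a..b} - \<Lambda>"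
  define B where "B = \<Lambda> - {a..b}"
  have \<Lambda>: "finite \<Lambda>" "\<Lambda> \<subseteq> {1..}" "card \<Lambda> = m"
    and max: "\<And>n k. n \<in> \<Lambda> \<Longrightarrow> k \<ge> 1 \<Longrightarrow> k \<notin> \<Lambda> \<Longrightarrow> norm (es k x) \<le> norm (es n x)"
    using gr by (auto simp: greedy_sets_def)
  have fin: "finite A" "finite B" "finite ({a..b} \<inter> \<Lambda>)" using \<Lambda> by (auto simp: A_def B_def)
  have es_y: "es k y = (if k \<in> {a..b} then 0 else es k x)" if "k \<ge> 1" for k
    using that I by (simp add: y_def es_diff es_P)
  have grB: "B \<in> greedy_sets es y (card B)"
    using \<Lambda> max es_y unfolding greedy_sets_def B_def by (auto simp: subset_iff)
  \<comment> \<open>Comparison with the empty partial sum is exactly quasi-greediness.\<close>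
  have yB: "norm (y - P B y) \<le> C * norm y"
    using pg[OF grB, of 0] by simp
  have PB: "P B y = P B x"
    using \<Lambda> by (intro P_cong) (auto simp: es_y B_def subset_iff)
  have "card A \<le> card B"
    unfolding A_def B_def using card_le_sym_Diff[of "{a..b}" \<Lambda>] \<Lambda> I by simp
  then have "norm (P A x) \<le> C * norm (P B x)"
    using I \<Lambda> max
    by (intro norm_coord_proj_left_le_right[OF pg, where b = b]) (auto simp: A_def B_def)
  also have "\<dots> \<le> C * (norm y + norm (y - P B y))"
    using C norm_triangle_ineq4[of y "y - P B y"] by (intro mult_left_mono) (auto simp: PB)
  also have "\<dots> \<le> C * (norm y + C * norm y)"
    using C yB by (intro mult_left_mono) auto
  finally have PA: "norm (P A x) \<le> C * (1 + C) * norm y" by (simp add: algebra_simps)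
  have "P {a..b} x = P A x + P ({a..b} \<inter> \<Lambda>) x" "P \<Lambda> x = P B x + P ({a..b} \<inter> \<Lambda>) x"
    using fin by (subst P_Un[symmetric]; auto simp: A_def B_def intro!: arg_cong2[of _ _ _ _ P])+
  then have "x - P \<Lambda> x = (y - P B y) + P A x" unfolding PB by (simp add: y_def)
  then have "norm (x - P \<Lambda> x) \<le> norm (y - P B y) + norm (P A x)"
    using norm_triangle_ineq by metis
  also have "\<dots> \<le> C * norm y + C * (1 + C) * norm y" using yB PA by linarith
  finally show ?thesis by (simp add: algebra_simps y_def)
qed

lemma sigma_hat_le:
  assumes "I = {} \<or> (int_interval I \<and> (\<forall>n\<in>\<Lambda>. Min I \<le> n) \<and> card I \<le> m)"
  shows "sigma_hat smul e es \<Lambda> m x \<le> norm (x - P I x)"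
  unfolding sigma_hat_def using assms
  by (intro cInf_lower) (auto intro!: bdd_belowI[of _ 0])

lemma sigma_hat_le_INF_partial_sums:
  assumes "\<Lambda> \<subseteq> {1..}"
  shows "sigma_hat smul e es \<Lambda> m x
    \<le> (INF k\<in>{0..m}. norm (x - (\<Sum>n=1..k. smul (es n x) (e n))))"
proof (rule cINF_greatest)
  fix k assume k: "k \<in> {0..m}"
  have "{1..k} = {} \<or>
      (int_interval {1..k} \<and> (\<forall>n\<in>\<Lambda>. Min {1..k} \<le> n) \<and> card {1..k} \<le> m)"
  proof (cases "k = 0")
    case False
    then have "Min {1..k} = 1" by (intro Min_eqI) auto
    moreover have "int_interval {1..k}" using False unfolding int_interval_def
      by (intro exI[of _ 1] exI[of _ k]) auto
    ultimately show ?thesis using k assms by (auto simp: subset_iff)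
  qed simp
  then show "sigma_hat smul e es \<Lambda> m x \<le> norm (x - (\<Sum>n=1..k. smul (es n x) (e n)))"
    using sigma_hat_le[of "{1..k}" \<Lambda> m x] by (simp add: coord_proj_def)
qed simp

lemma norm_greedy_remainder_le_sigma_hat:
  assumes C: "C \<ge> 1"
    and pg: "\<And>x \<Lambda> k. \<Lambda> \<in> greedy_sets es x (card \<Lambda>) \<Longrightarrow> k \<le> card \<Lambda> \<Longrightarrow>
      norm (x - P \<Lambda> x) \<le> C * norm (x - P {1..k} x)"
    and gr: "\<Lambda> \<in> greedy_sets es x m"
  shows "norm (x - P \<Lambda> x) \<le> (C + C * (1 + C)) * sigma_hat smul e es \<Lambda> m x"
proof -
  define D where "D = C + C * (1 + C)"
  have D: "C \<le> D" "D > 0" using C by (auto simp: D_def add_pos_pos)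
  have bound: "norm (x - P \<Lambda> x) \<le> D * norm (x - P I x)"
    if I: "I = {} \<or> (int_interval I \<and> (\<forall>n\<in>\<Lambda>. Min I \<le> n) \<and> card I \<le> m)" for I
    using I
  proof
    assume "I = {}"
    moreover have "norm (x - P \<Lambda> x) \<le> C * norm x"
      using pg[of \<Lambda> x 0] gr by (simp add: greedy_sets_def)
    moreover have "C * norm x \<le> D * norm x" using D by (intro mult_right_mono) auto
    ultimately show ?thesis by simp
  next
    assume *: "int_interval I \<and> (\<forall>n\<in>\<Lambda>. Min I \<le> n) \<and> card I \<le> m"
    then obtain a b where ab: "1 \<le> a" "a \<le> b" "I = {a..b}" by (auto simp: int_interval_def)
    then have "Min I = a" by (auto intro!: Min_eqI)
    with * ab show ?thesis
      using norm_greedy_remainder_le_interval_remainder[OF C pg gr, of a b] by (simp add: D_def)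
  qed
  have "norm (x - P \<Lambda> x) / D \<le> sigma_hat smul e es \<Lambda> m x"
    unfolding sigma_hat_def
  proof (rule cInf_greatest)
    fix r assume "r \<in> {norm (x - P I x) | I.
      I = {} \<or> (int_interval I \<and> (\<forall>n\<in>\<Lambda>. Min I \<le> n) \<and> card I \<le> m)}"
    then show "norm (x - P \<Lambda> x) / D \<le> r"
      using bound D(2) by (clarsimp simp only: pos_divide_le_eq mult.commute[of _ D])
  qed blast
  then show ?thesis using D by (simp add: D_def[symmetric] divide_le_eq mult.commute)
qed

end

theorem theorem1p2:
  fixes smul :: "'k::real_normed_field \<Rightarrow> 'a::banach \<Rightarrow> 'a"
    and e :: "nat \<Rightarrow> 'a"
    and es :: "nat \<Rightarrow> 'a \<Rightarrow> 'k"
  assumes "banach_space_over smul"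
    and "infinite_dimensional smul"
    and "is_basis smul e es"
  shows "partially_greedy smul e es \<longleftrightarrow>
    (\<exists>C\<ge>1. \<forall>x. \<forall>m\<ge>1. \<forall>\<Lambda>\<in>greedy_sets es x m.
       norm (x - coord_proj smul e es \<Lambda> x) \<le> C * sigma_hat smul e es \<Lambda> m x)"
    (is "_ \<longleftrightarrow> ?interval_greedy")
proof -
  interpret banach_space_over smul by fact
  interpret biorthogonal_system smul e es
    by unfold_locales (use assms(3) in \<open>auto simp: is_basis_def\<close>)
  show ?thesis
  proof
    assume "partially_greedy smul e es"
    then obtain C where C: "C \<ge> 1"
      and pg: "\<And>x \<Lambda> k. \<Lambda> \<in> greedy_sets es x (card \<Lambda>) \<Longrightarrow> k \<le> card \<Lambda> \<Longrightarrow>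
        norm (x - P \<Lambda> x) \<le> C * norm (x - P {1..k} x)"
      using partially_greedyE by metis
    have "C + C * (1 + C) \<ge> 1" using C by (simp add: add_increasing2)
    then show ?interval_greedy
      using norm_greedy_remainder_le_sigma_hat[OF C pg] by blast
  next
    assume ?interval_greedy
    then obtain C where C: "C \<ge> 1" and bound: "\<And>x m \<Lambda>. m \<ge> 1 \<Longrightarrow> \<Lambda> \<in> greedy_sets es x m \<Longrightarrow>
        norm (x - P \<Lambda> x) \<le> C * sigma_hat smul e es \<Lambda> m x"
      by blast
    have "norm (x - P \<Lambda> x)
        \<le> C * (INF k\<in>{0..m}. norm (x - (\<Sum>n=1..k. smul (es n x) (e n))))"
      if "m \<ge> 1" "\<Lambda> \<in> greedy_sets es x m" for x m \<Lambda>
    proof -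
      have "\<Lambda> \<subseteq> {1..}" using that by (simp add: greedy_sets_def)
      then show ?thesis
        using C by (intro order_trans[OF bound[OF that]] mult_left_mono
            sigma_hat_le_INF_partial_sums) auto
    qed
    with C show "partially_greedy smul e es" unfolding partially_greedy_def by blast
  qed
qed

end
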